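(* (Completeness) For every set $\Gamma$ of formulae of $\mathcal{L}_{\succ}$ and every formula $\phi$ of $\mathcal{L}_{\succ}$: if $\Gamma \models_{\mathcal{C}_K^{\mathbf{LCR}}} \phi$, then $\Gamma \vdash_{\mathbf{LCR}} \phi$.
   Context: Fix an integer $m\ge 2$ and let $\mathcal{T}=\{0,\frac{1}{m-1},\dots,\frac{m-2}{m-1},1\}$ with its natural order. For $a,b\in\mathcal{T}$ put $\sim a=1-a$, $a\rightarrow b=\min\{1,1-a+b\}$, $a\odot b=\max\{0,a+b-1\}$. The language $\mathcal{L}_{\succ}$ has a countable set $\Pi$ of propositional variables, the unary connective $\neg$ and the binary connectives $\rightarrow$ and $\succ$; formulae are built as usual. Abbreviations: $\mathbf{t}:=p\rightarrow p$ (for a fixed variable $p$), $\phi\vee\psi:=(\phi\rightarrow\psi)\rightarrow\psi$, $\phi\wedge\psi:=\neg(\neg\phi\vee\neg\psi)$, $\phi\leftrightarrow\psi:=(\phi\rightarrow\psi)\wedge(\psi\rightarrow\phi)$. For $a\in\mathcal{T}$, $\mathbf{J}_a(\phi)$ is a fixed formula built from $\phi$ with $\neg,\rightarrow$ (the Rosser–Turquette $J$-operator of Łukasiewicz $m$-valued logic) whose value is $1$ if the value of $\phi$ is $a$ and $0$ otherwise; $\mathbf{I}_a(\phi):=\mathbf{J}_a(\phi)\vee\dots\vee\mathbf{J}_1(\phi)$ (disjunction over all $b\in\mathcal{T}$ with $b\ge a$), whose value is $1$ if the value of $\phi$ is $\ge a$ and $0$ otherwise. Iterated implication: $\rightarrow_{i=1}^{0}(\phi_i,\psi):=\psi$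 and $\rightarrow_{i=1}^{k}(\phi_i,\psi):=\phi_k\rightarrow(\rightarrow_{i=1}^{k-1}(\phi_i,\psi))$. A Kripke $\mathbf{LCR}$ model is $\mathfrak{J}=\langle W,\mathcal{A},\{R_X:X\in\mathcal{A}\},\nu\rangle$ with $W$ a nonempty set, $\mathcal{A}\subseteq(\mathcal{P}(W))^m$, each $R_X:W\times W\to\mathcal{T}$ (write $xR_Xy$ for its value), and $\nu:\Pi\times W\to\mathcal{T}$ (write $\nu_x(p)$). It is extended to all formulae by $\nu_x(\neg\phi)=\sim\nu_x(\phi)$, $\nu_x(\phi\rightarrow\psi)=\nu_x(\phi)\rightarrow\nu_x(\psi)$, $\nu_x(\phi\succ\psi)=\bigwedge\{xR_{|\phi|}y\rightarrow\nu_y(\psi):y\in W\}$ (infimum), where $|\phi|=(|\phi|_1,\dots,|\phi|_m)$ with $|\phi|_i=\{x\in W:\nu_x(\phi)=\frac{i-1}{m-1}\}$ (the semantics presupposes $|\phi|\in\mathcal{A}$). For a class $\mathcal{C}$ of such models, $\Sigma\models_{\mathcal{C}}\phi$ means: for every model in $\mathcal{C}$ and every world $w$, if $\nu_w(\psi)=1$ for all $\psi\in\Sigma$ then $\nu_w(\phi)=1$. $\mathcal{C}_K^{\mathbf{LCR}}$ is the class of all Kripke $\mathbf{LCR}$ models. The system $\mathbf{LCR}$: all $\mathcal{L}_{\succ}$-instances of the axioms of a (complete) axiomatization of Łukasiewicz $m$-valued propositional logic $\mathbf{L}$ with modus ponens (MP), plus the axioms A1: $(\phi\succ(\psi\wedge\theta))\rightarrow((\phi\succ\psi)\wedge(\phi\succ\theta))$;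 A2: $((\phi\succ\psi)\wedge(\phi\succ\theta))\rightarrow(\phi\succ(\psi\wedge\theta))$; A3: $\phi\succ\mathbf{t}$; and the rules (RCEA): from $\phi\leftrightarrow\psi$ infer $(\phi\succ\theta)\leftrightarrow(\psi\succ\theta)$; (RCEC): from $\phi\leftrightarrow\psi$ infer $(\theta\succ\phi)\leftrightarrow(\theta\succ\psi)$; $(\mathrm{R}_a)$ for each $a\in\mathcal{T}$: from $\rightarrow_{i=1}^{m}(\mathbf{I}_{a_i\odot b}(\gamma_i),\mathbf{I}_{a\odot b}(\gamma))$ for every $b\in\mathcal{T}$, infer $\rightarrow_{i=1}^{m}(\mathbf{I}_{a_i}(\phi\succ\gamma_i),\mathbf{I}_{a}(\phi\succ\gamma))$, where $a_i=\frac{m-i}{m-1}$. $\vdash_{\mathbf{LCR}}\phi$ means $\phi$ is a theorem of $\mathbf{LCR}$; $\Gamma\vdash_{\mathbf{LCR}}\phi$ means there is a finite sequence ending with $\phi$ each member of which is a theorem of $\mathbf{LCR}$, a member of $\Gamma$, or obtained by MP from earlier members. *)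

theory Defs
  imports Complex_Main "HOL-Library.Countable"
begin

definition tval :: "nat \<Rightarrow> nat \<Rightarrow> real" where
  "tval m i = real i / real (m - 1)"

definition truth_list :: "nat \<Rightarrow> real list" where
  "truth_list m = map (tval m) [0..<m]"

definition truth_values :: "nat \<Rightarrow> real set" where
  "truth_values m = set (truth_list m)"

definition tneg :: "real \<Rightarrow> real" where
  "tneg a = 1 - a"

definition timp :: "real \<Rightarrow> real \<Rightarrow> real" where
  "timp a b = min 1 (1 - a + b)"

definition todot :: "real \<Rightarrow> real \<Rightarrow> real" where
  "todot a b = max 0 (a + b - 1)"

text \<open>
  Formulae of the propositional language serve as axiom schemes: their variables are replaced by
  arbitrary formulae, so they range over a fixed infinite supply.
\<close>

datatype lfm = LVar nat | LNeg lfm | LImp lfm lfm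

primrec lval :: "(nat \<Rightarrow> real) \<Rightarrow> lfm \<Rightarrow> real" where
  "lval v (LVar n) = v n"
| "lval v (LNeg \<alpha>) = tneg (lval v \<alpha>)"
| "lval v (LImp \<alpha> \<beta>) = timp (lval v \<alpha>) (lval v \<beta>)"

definition ltaut :: "nat \<Rightarrow> lfm \<Rightarrow> bool" where
  "ltaut m \<alpha> \<longleftrightarrow> (\<forall>v. (\<forall>n. v n \<in> truth_values m) \<longrightarrow> lval v \<alpha> = 1)"

primrec lsubst :: "(nat \<Rightarrow> lfm) \<Rightarrow> lfm \<Rightarrow> lfm" where
  "lsubst \<sigma> (LVar n) = \<sigma> n"
| "lsubst \<sigma> (LNeg \<alpha>) = LNeg (lsubst \<sigma> \<alpha>)"
| "lsubst \<sigma> (LImp \<alpha> \<beta>) = LImp (lsubst \<sigma> \<alpha>) (lsubst \<sigma> \<beta>)"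

inductive L_thm :: "lfm set \<Rightarrow> lfm \<Rightarrow> bool" for Ax :: "lfm set" where
  L_Ax: "\<alpha> \<in> Ax \<Longrightarrow> L_thm Ax (lsubst \<sigma> \<alpha>)"
| L_MP: "L_thm Ax \<alpha> \<Longrightarrow> L_thm Ax (LImp \<alpha> \<beta>) \<Longrightarrow> L_thm Ax \<beta>"

definition L_axiomatization :: "nat \<Rightarrow> lfm set \<Rightarrow> bool" where
  "L_axiomatization m Ax \<longleftrightarrow> (\<forall>\<alpha>. L_thm Ax \<alpha> \<longleftrightarrow> ltaut m \<alpha>)"

text \<open>
  The operator \<open>\<^bold>J\<^sub>a\<close> is given by a scheme \<open>J a\<close>, all of whose variables are replaced by the
  argument (see \<open>Jop\<close> below); hence only valuations constant on the variables matter.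
\<close>

definition J_schemes :: "nat \<Rightarrow> (real \<Rightarrow> lfm) \<Rightarrow> bool" where
  "J_schemes m J \<longleftrightarrow>
     (\<forall>a\<in>truth_values m. \<forall>x\<in>truth_values m.
        lval (\<lambda>_. x) (J a) = (if x = a then 1 else 0))"

datatype 'v fm = Var 'v | Neg "'v fm" | Imp "'v fm" "'v fm" | Cond "'v fm" "'v fm"

definition Top :: "'v \<Rightarrow> 'v fm" where
  "Top p = Imp (Var p) (Var p)"

definition Or :: "'v fm \<Rightarrow> 'v fm \<Rightarrow> 'v fm" where
  "Or \<phi> \<psi> = Imp (Imp \<phi> \<psi>) \<psi>"

definition And :: "'v fm \<Rightarrow> 'v fm \<Rightarrow> 'v fm" where
  "And \<phi> \<psi> = Neg (Or (Neg \<phi>) (Neg \<psi>))"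

definition Iff :: "'v fm \<Rightarrow> 'v fm \<Rightarrow> 'v fm" where
  "Iff \<phi> \<psi> = And (Imp \<phi> \<psi>) (Imp \<psi> \<phi>)"

primrec inst :: "(nat \<Rightarrow> 'v fm) \<Rightarrow> lfm \<Rightarrow> 'v fm" where
  "inst \<sigma> (LVar n) = \<sigma> n"
| "inst \<sigma> (LNeg \<alpha>) = Neg (inst \<sigma> \<alpha>)"
| "inst \<sigma> (LImp \<alpha> \<beta>) = Imp (inst \<sigma> \<alpha>) (inst \<sigma> \<beta>)"

definition Jop :: "(real \<Rightarrow> lfm) \<Rightarrow> real \<Rightarrow> 'v fm \<Rightarrow> 'v fm" where
  "Jop J a \<phi> = inst (\<lambda>_. \<phi>) (J a)"

text \<open>Disjunctions are bracketed to the right; the empty list is never used.\<close>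

fun Disj :: "'v fm list \<Rightarrow> 'v fm" where
  "Disj [\<phi>] = \<phi>"
| "Disj (\<phi> # \<psi> # \<phi>s) = Or \<phi> (Disj (\<psi> # \<phi>s))"

definition Iop :: "nat \<Rightarrow> (real \<Rightarrow> lfm) \<Rightarrow> real \<Rightarrow> 'v fm \<Rightarrow> 'v fm" where
  "Iop m J a \<phi> = Disj (map (\<lambda>b. Jop J b \<phi>) (filter (\<lambda>b. a \<le> b) (truth_list m)))"

primrec iter_imp :: "nat \<Rightarrow> (nat \<Rightarrow> 'v fm) \<Rightarrow> 'v fm \<Rightarrow> 'v fm" where
  "iter_imp 0 \<phi> \<psi> = \<psi>"
| "iter_imp (Suc k) \<phi> \<psi> = Imp (\<phi> (Suc k)) (iter_imp k \<phi> \<psi>)"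

text \<open>An \<open>m\<close>-tuple of sets of worlds is a list of length \<open>m\<close>.\<close>

record ('w, 'v) kripke =
  worlds :: "'w set"
  adm :: "'w set list set"
  rel :: "'w set list \<Rightarrow> 'w \<Rightarrow> 'w \<Rightarrow> real"
  val :: "'v \<Rightarrow> 'w \<Rightarrow> real"

primrec eval :: "nat \<Rightarrow> ('w, 'v) kripke \<Rightarrow> 'v fm \<Rightarrow> 'w \<Rightarrow> real" where
  "eval m M (Var q) x = val M q x"
| "eval m M (Neg \<phi>) x = tneg (eval m M \<phi> x)"
| "eval m M (Imp \<phi> \<psi>) x = timp (eval m M \<phi> x) (eval m M \<psi> x)"
| "eval m M (Cond \<phi> \<psi>) x =
     (INF y\<in>worlds M.
        timp (rel M (map (\<lambda>i. {z \<in> worlds M. eval m M \<phi> z = tval m (i - 1)}) [1..<Suc m]) x y)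
             (eval m M \<psi> y))"

definition ext :: "nat \<Rightarrow> ('w, 'v) kripke \<Rightarrow> 'v fm \<Rightarrow> 'w set list" where
  "ext m M \<phi> = map (\<lambda>i. {z \<in> worlds M. eval m M \<phi> z = tval m (i - 1)}) [1..<Suc m]"

lemma eval_Cond:
  "eval m M (Cond \<phi> \<psi>) x =
     (INF y\<in>worlds M. timp (rel M (ext m M \<phi>) x y) (eval m M \<psi> y))"
  by (simp add: ext_def)

text \<open>
  The last conjunct is the presupposition that makes the clause for \<open>\<succ>\<close> meaningful: \<open>rel\<close> is
  constrained only at members of \<open>adm\<close>.
\<close>

definition LCR_model :: "nat \<Rightarrow> ('w, 'v) kripke \<Rightarrow> bool" where
  "LCR_model m M \<longleftrightarrow>
     worlds M \<noteq> {} \<and>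
     adm M \<subseteq> {X. length X = m \<and> set X \<subseteq> Pow (worlds M)} \<and>
     (\<forall>X\<in>adm M. \<forall>x\<in>worlds M. \<forall>y\<in>worlds M. rel M X x y \<in> truth_values m) \<and>
     (\<forall>q. \<forall>x\<in>worlds M. val M q x \<in> truth_values m) \<and>
     (\<forall>\<phi>. ext m M \<phi> \<in> adm M)"

text \<open>
  Since HOL cannot quantify over types inside a formula, the class of all models is relative to a
  type \<open>'w\<close> from which the worlds are drawn; \<open>worlds M\<close> is an arbitrary nonempty subset of it.
\<close>

definition LCR_models :: "nat \<Rightarrow> ('w, 'v) kripke set" where
  "LCR_models m = {M. LCR_model m M}"

definition entails :: "nat \<Rightarrow> ('w, 'v) kripke set \<Rightarrow> 'v fm set \<Rightarrow> 'v fm \<Rightarrow> bool" where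
  "entails m C \<Sigma> \<phi> \<longleftrightarrow>
     (\<forall>M\<in>C. \<forall>w\<in>worlds M. (\<forall>\<psi>\<in>\<Sigma>. eval m M \<psi> w = 1) \<longrightarrow> eval m M \<phi> w = 1)"

inductive LCR_thm :: "nat \<Rightarrow> lfm set \<Rightarrow> (real \<Rightarrow> lfm) \<Rightarrow> 'v \<Rightarrow> 'v fm \<Rightarrow> bool"
  for m :: nat and Ax :: "lfm set" and J :: "real \<Rightarrow> lfm" and p :: 'v where
  Ax: "\<alpha> \<in> Ax \<Longrightarrow> LCR_thm m Ax J p (inst \<sigma> \<alpha>)"
| MP: "LCR_thm m Ax J p \<phi> \<Longrightarrow> LCR_thm m Ax J p (Imp \<phi> \<psi>) \<Longrightarrow> LCR_thm m Ax J p \<psi>"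
| A1: "LCR_thm m Ax J p (Imp (Cond \<phi> (And \<psi> \<theta>)) (And (Cond \<phi> \<psi>) (Cond \<phi> \<theta>)))"
| A2: "LCR_thm m Ax J p (Imp (And (Cond \<phi> \<psi>) (Cond \<phi> \<theta>)) (Cond \<phi> (And \<psi> \<theta>)))"
| A3: "LCR_thm m Ax J p (Cond \<phi> (Top p))"
| RCEA: "LCR_thm m Ax J p (Iff \<phi> \<psi>) \<Longrightarrow> LCR_thm m Ax J p (Iff (Cond \<phi> \<theta>) (Cond \<psi> \<theta>))"
| RCEC: "LCR_thm m Ax J p (Iff \<phi> \<psi>) \<Longrightarrow> LCR_thm m Ax J p (Iff (Cond \<theta> \<phi>) (Cond \<theta> \<psi>))"
| R: "a \<in> truth_values m \<Longrightarrow>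
      (\<And>b. b \<in> truth_values m \<Longrightarrow>
         LCR_thm m Ax J p
           (iter_imp m (\<lambda>i. Iop m J (todot (tval m (m - i)) b) (\<gamma>s i)) (Iop m J (todot a b) \<gamma>))) \<Longrightarrow>
      LCR_thm m Ax J p
        (iter_imp m (\<lambda>i. Iop m J (tval m (m - i)) (Cond \<phi> (\<gamma>s i))) (Iop m J a (Cond \<phi> \<gamma>)))"

definition LCR_derives ::
  "nat \<Rightarrow> lfm set \<Rightarrow> (real \<Rightarrow> lfm) \<Rightarrow> 'v \<Rightarrow> 'v fm set \<Rightarrow> 'v fm \<Rightarrow> bool" where
  "LCR_derives m Ax J p \<Gamma> \<phi> \<longleftrightarrow>
     (\<exists>ds. ds \<noteq> [] \<and> last ds = \<phi> \<and>
        (\<forall>i<length ds.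
           LCR_thm m Ax J p (ds ! i) \<or> ds ! i \<in> \<Gamma> \<or>
           (\<exists>j<i. \<exists>k<i. ds ! k = Imp (ds ! j) (ds ! i))))"

text \<open>
  The hypotheses \<open>L_axiomatization\<close> and \<open>J_schemes\<close> are satisfiable for every \<open>m \<ge> 2\<close>.
\<close>

lemma tval_in: "m \<ge> 2 \<Longrightarrow> i < m \<Longrightarrow> tval m i \<in> truth_values m"
  by (auto simp: truth_values_def truth_list_def)

lemma truth_valuesE:
  assumes "a \<in> truth_values m"
  obtains i where "i < m" "a = tval m i"
  using assms by (auto simp: truth_values_def truth_list_def)

lemma tneg_closed:
  assumes "m \<ge> 2" "a \<in> truth_values m"
  shows "tneg a \<in> truth_values m"
proof -
  obtain i where i: "i < m" "a = tval m i" using assms(2) by (rule truth_valuesE)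
  have "tneg a = tval m (m - 1 - i)"
    using assms(1) i by (simp add: tneg_def tval_def of_nat_diff field_simps)
  then show ?thesis using assms(1) tval_in[of m "m - 1 - i"] by simp
qed

lemma timp_closed:
  assumes "m \<ge> 2" "a \<in> truth_values m" "b \<in> truth_values m"
  shows "timp a b \<in> truth_values m"
proof -
  obtain i where i: "i < m" "a = tval m i" using assms(2) by (rule truth_valuesE)
  obtain j where j: "j < m" "b = tval m j" using assms(3) by (rule truth_valuesE)
  show ?thesis
  proof (cases "i \<le> j")
    case True
    then have "a \<le> b" using assms(1) i j by (simp add: tval_def divide_right_mono)
    then have "timp a b = tval m (m - 1)"
      using assms(1) by (simp add: timp_def tval_def)
    then show ?thesis using assms(1) tval_in[of m "m - 1"] by simp
  next
    case False
    then have "b \<le> a" using assms(1) i j by (simp add: tval_def divide_right_mono)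
    then have "timp a b = 1 - a + b" by (simp add: timp_def)
    also have "\<dots> = tval m (m - 1 - i + j)"
      using assms(1) i j by (simp add: tval_def of_nat_diff field_simps)
    finally show ?thesis using False assms(1) i tval_in[of m "m - 1 - i + j"] by simp
  qed
qed

lemma lval_closed:
  "m \<ge> 2 \<Longrightarrow> \<forall>n. v n \<in> truth_values m \<Longrightarrow> lval v \<alpha> \<in> truth_values m"
  by (induction \<alpha>) (auto intro: tneg_closed timp_closed)

lemma lval_lsubst: "lval v (lsubst \<sigma> \<alpha>) = lval (\<lambda>n. lval v (\<sigma> n)) \<alpha>"
  by (induction \<alpha>) auto

lemma lsubst_LVar: "lsubst LVar \<alpha> = \<alpha>"
  by (induction \<alpha>) auto

lemma truth_le_1: "m \<ge> 2 \<Longrightarrow> a \<in> truth_values m \<Longrightarrow> 0 \<le> a \<and> a \<le> 1"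
  by (elim truth_valuesE) (simp add: tval_def)

lemma L_axiomatization_exists:
  assumes "m \<ge> 2"
  shows "\<exists>Ax. L_axiomatization m Ax"
proof -
  have sound: "ltaut m \<alpha>" if "L_thm {\<alpha>. ltaut m \<alpha>} \<alpha>" for \<alpha>
    using that
  proof induction
    case (L_Ax \<alpha> \<sigma>)
    then show ?case using lval_closed[OF assms] by (auto simp: ltaut_def lval_lsubst)
  next
    case (L_MP \<alpha> \<beta>)
    show ?case unfolding ltaut_def
    proof (intro allI impI)
      fix v :: "nat \<Rightarrow> real" assume v: "\<forall>n. v n \<in> truth_values m"
      then have "lval v \<alpha> = 1" "timp (lval v \<alpha>) (lval v \<beta>) = 1"
        using L_MP.IH by (auto simp: ltaut_def)
      moreover have "lval v \<beta> \<le> 1" using lval_closed[OF assms v] truth_le_1[OF assms] by blast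
      ultimately show "lval v \<beta> = 1" by (simp add: timp_def min_def split: if_splits)
    qed
  qed
  have complete: "L_thm {\<alpha>. ltaut m \<alpha>} \<alpha>" if "ltaut m \<alpha>" for \<alpha>
    using L_Ax[of \<alpha> "{\<alpha>. ltaut m \<alpha>}" LVar] that by (simp add: lsubst_LVar)
  show ?thesis unfolding L_axiomatization_def using sound complete by blast
qed

text \<open>\<open>clamp_fm k j\<close> has value \<open>min 1 (max 0 (k * x - j))\<close> when all variables have value \<open>x\<close>.\<close>

fun clamp_fm :: "nat \<Rightarrow> int \<Rightarrow> lfm" where
  "clamp_fm 0 j =
     (if j < 0 then LImp (LVar 0) (LVar 0) else LNeg (LImp (LVar 0) (LVar 0)))"
| "clamp_fm (Suc k) j =
     LNeg (LImp (LImp (LNeg (clamp_fm k j)) (LVar 0)) (LNeg (clamp_fm k (j - 1))))"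

lemma lval_clamp_fm:
  assumes "0 \<le> x" "x \<le> 1"
  shows "lval (\<lambda>_. x) (clamp_fm k j) = min 1 (max 0 (real k * x - of_int j))"
proof (induction k arbitrary: j)
  case 0
  have "j < 0 \<Longrightarrow> of_int j \<le> (-1::real)" by linarith
  then show ?case by (auto simp: timp_def tneg_def)
next
  case (Suc k)
  show ?case using assms
    by (simp add: Suc timp_def tneg_def algebra_simps min_def max_def)
qed

lemma J_schemes_exist:
  assumes "m \<ge> 2"
  shows "\<exists>J. J_schemes m J"
proof -
  have "\<exists>\<alpha>. \<forall>x\<in>truth_values m. lval (\<lambda>_. x) \<alpha> = (if x = a then 1 else 0)"
    if a: "a \<in> truth_values m" for a
  proof -
    obtain i where i: "i < m" "a = tval m i" using a by (rule truth_valuesE)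
    let ?ge = "\<lambda>j. clamp_fm (m - 1) (int j - 1)"
    have ge: "lval (\<lambda>_. tval m l) (?ge j) = (if j \<le> l then 1 else 0)" if "l < m" for l j
    proof -
      have "real (m - 1) * tval m l = real l" using assms by (simp add: tval_def)
      moreover have "0 \<le> tval m l" "tval m l \<le> 1"
        using truth_le_1[OF assms tval_in[OF assms that]] by auto
      ultimately show ?thesis by (auto simp: lval_clamp_fm)
    qed
    have "lval (\<lambda>_. x) (LNeg (LImp (?ge i) (?ge (Suc i)))) = (if x = a then 1 else 0)"
      if x: "x \<in> truth_values m" for x
    proof -
      obtain l where l: "l < m" "x = tval m l" using x by (rule truth_valuesE)
      have "x = a \<longleftrightarrow> l = i" using assms i l by (simp add: tval_def)
      then show ?thesis using ge[OF l(1), of i] ge[OF l(1), of "Suc i"] l(2)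
        by (auto simp: timp_def tneg_def)
    qed
    then show ?thesis by blast
  qed
  then show ?thesis unfolding J_schemes_def by metis
qed

end

theory Submission
  imports Defs
begin

text \<open>
  The worlds of the canonical model are the \<open>m\<close>-valued homomorphisms \<open>h\<close> that give every theorem
  the value 1, and \<open>h R\<^sub>\<phi> g\<close> is the infimum over all \<open>\<chi>\<close> of \<open>h (\<phi> \<succ> \<chi>) \<rightarrow> g \<chi>\<close>; by (RCEA) it only
  depends on the extension of \<open>\<phi>\<close>. If \<open>h (\<phi> \<succ> \<psi>) < a\<close> although \<open>a \<le> (h R\<^sub>\<phi> g \<rightarrow> g \<psi>)\<close> for all \<open>g\<close>,
  then for each \<open>b\<close> the inequalities \<open>h (\<phi> \<succ> \<chi>) \<odot> b \<le> g \<chi>\<close> entail \<open>a \<odot> b \<le> g \<psi>\<close>. By compactness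
  finitely many \<open>\<chi>\<close> suffice, for all \<open>b\<close> at once. The conjunctions \<open>\<gamma>\<^sub>i\<close> of those \<open>\<chi>\<close> with
  \<open>h (\<phi> \<succ> \<chi>) = a\<^sub>i\<close> satisfy the premises of \<open>(R\<^sub>a)\<close>, whose conclusion contradicts \<open>h (\<phi> \<succ> \<psi>) < a\<close>.
\<close>

section \<open>Compactness for finitely many truth values\<close>

text \<open>Koenig's argument: \<open>good k u\<close> says that no finite subfamily rules out the
  first \<open>k\<close> entries of \<open>u\<close>, and \<open>local\<close> puts the limit of
  good prefixes into every member of \<open>\<P>\<close>.\<close>

lemma finite_valued_compactness:
  fixes T :: "'a set" and \<P> :: "(nat \<Rightarrow> 'a) set set"
  assumes "finite T"
    and local: "\<And>P. P \<in> \<P> \<Longrightarrow> \<exists>N. \<forall>v w. (\<forall>n<N. v n = w n) \<longrightarrow> v \<in> P \<longrightarrow> w \<in> P"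
    and fip: "\<And>F. finite F \<Longrightarrow> F \<subseteq> \<P> \<Longrightarrow> \<exists>v. range v \<subseteq> T \<and> v \<in> \<Inter>F"
  shows "\<exists>v. range v \<subseteq> T \<and> v \<in> \<Inter>\<P>"
proof -
  define good where "good k u \<longleftrightarrow>
    (\<forall>F. finite F \<longrightarrow> F \<subseteq> \<P> \<longrightarrow> (\<exists>v. range v \<subseteq> T \<and> (\<forall>n<k. v n = u n) \<and> v \<in> \<Inter>F))" for k u
  have step: "\<exists>t. good (Suc k) (u(k := t))" if ku: "good k u" for k u
  proof (rule ccontr)
    assume "\<nexists>t. good (Suc k) (u(k := t))"
    then have "\<forall>t. \<exists>F. finite F \<and> F \<subseteq> \<P> \<and>
      \<not> (\<exists>v. range v \<subseteq> T \<and> (\<forall>n<Suc k. v n = (u(k := t)) n) \<and> v \<in> \<Inter>F)"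
      by (simp only: good_def not_ex not_all not_imp simp_thms)
    then obtain F where "\<forall>t. finite (F t) \<and> F t \<subseteq> \<P> \<and>
      \<not> (\<exists>v. range v \<subseteq> T \<and> (\<forall>n<Suc k. v n = (u(k := t)) n) \<and> v \<in> \<Inter>(F t))"
      by (rule choice[THEN exE])
    then have F: "\<And>t. finite (F t)" "\<And>t. F t \<subseteq> \<P>"
      and no: "\<And>t v. range v \<subseteq> T \<Longrightarrow> \<forall>n<Suc k. v n = (u(k := t)) n \<Longrightarrow> v \<notin> \<Inter>(F t)"
      by blast+
    \<comment> \<open>Finiteness of \<open>T\<close> lets the refuting families be united into a
      finite one; a point \<open>v\<close> in its intersection contradicts the choice of
      \<open>F (v k)\<close>.\<close>
    have "finite (\<Union>t\<in>T. F t)" "(\<Union>t\<in>T. F t) \<subseteq> \<P>" using F \<open>finite T\<close> by auto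
    then obtain v where v: "range v \<subseteq> T" "\<forall>n<k. v n = u n" "v \<in> \<Inter>(\<Union>t\<in>T. F t)"
      using ku[unfolded good_def, rule_format, of "\<Union>t\<in>T. F t"] by blast
    have "v \<notin> \<Inter>(F (v k))" by (rule no) (use v in \<open>auto simp: less_Suc_eq\<close>)
    moreover have "v k \<in> T" using v(1) by auto
    ultimately show False using v(3) by auto
  qed
  have "\<exists>f. \<forall>k. good k (f k) \<and> (\<exists>t. f (Suc k) = (f k)(k := t))"
  proof (rule dependent_nat_choice)
    show "\<exists>u. good 0 u" using fip by (simp add: good_def)
  qed (use step in blast)
  then obtain f where good: "\<And>k. good k (f k)" and upd: "\<And>k. \<exists>t. f (Suc k) = (f k)(k := t)"
    by blast
  \<comment> \<open>Entry \<open>n\<close> is set in passing to stage \<open>Suc n\<close> and never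
    changed afterwards.\<close>
  define v where "v n = f (Suc n) n" for n
  have agree: "n < k \<Longrightarrow> f k n = v n" for k n
  proof (induction k)
    case (Suc k)
    obtain t where "f (Suc k) = (f k)(k := t)" using upd by blast
    with Suc show ?case by (cases "n = k") (auto simp: v_def)
  qed simp
  have "v n \<in> T" for n
  proof -
    obtain w where "range w \<subseteq> T" "\<forall>i<Suc n. w i = f (Suc n) i"
      using good[of "Suc n", unfolded good_def, rule_format, of "{}"] by auto
    then have "v n = w n" by (simp add: v_def)
    with \<open>range w \<subseteq> T\<close> show ?thesis by auto
  qed
  moreover have "v \<in> P" if P: "P \<in> \<P>" for P
  proof -
    obtain N where N: "\<forall>v w. (\<forall>n<N. v n = w n) \<longrightarrow> v \<in> P \<longrightarrow> w \<in> P" using local[OF P] by blast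
    obtain w where "\<forall>n<N. w n = f N n" "w \<in> \<Inter>{P}"
      using good[of N, unfolded good_def, rule_format, of "{P}"] P by auto
    then have "\<forall>n<N. w n = v n" "w \<in> P" using agree by auto
    then show ?thesis using N by blast
  qed
  ultimately show ?thesis by blast
qed

text \<open>Only finitely many variables occur in a formula; this supplies the locality hypothesis
  for compactness.\<close>

lemma lval_finite_support: "\<exists>N. \<forall>v w. (\<forall>n<N. v n = w n) \<longrightarrow> lval v \<alpha> = lval w \<alpha>"
proof (induction \<alpha>)
  case (LVar n)
  show ?case by (rule exI[of _ "Suc n"]) simp
next
  case (LImp \<alpha> \<beta>)
  then obtain N M where
    "\<forall>v w. (\<forall>n<N. v n = w n) \<longrightarrow> lval v \<alpha> = lval w \<alpha>"
    "\<forall>v w. (\<forall>n<M. v n = w n) \<longrightarrow> lval v \<beta> = lval w \<beta>" by blast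
  then show ?case by (intro exI[of _ "max N M"]) (metis lval.simps(3) less_max_iff_disj)
qed (metis lval.simps(2))


section \<open>Homomorphisms into the truth values\<close>

instance fm :: (countable) countable
  by countable_datatype

definition homs :: "nat \<Rightarrow> ('v fm \<Rightarrow> real) set" where
  "homs m = {h. range h \<subseteq> truth_values m \<and> (\<forall>\<phi>. h (Neg \<phi>) = tneg (h \<phi>)) \<and>
     (\<forall>\<phi> \<psi>. h (Imp \<phi> \<psi>) = timp (h \<phi>) (h \<psi>))}"

text \<open>Variables and conditionals alike become numbered propositional atoms, so that members of
  \<open>homs\<close> correspond to valuations and the propositional axiomatization applies.\<close>

primrec scheme :: "'v::countable fm \<Rightarrow> lfm" where
  "scheme (Var q) = LVar (to_nat (Var q))"
| "scheme (Neg \<phi>) = LNeg (scheme \<phi>)"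
| "scheme (Imp \<phi> \<psi>) = LImp (scheme \<phi>) (scheme \<psi>)"
| "scheme (Cond \<phi> \<psi>) = LVar (to_nat (Cond \<phi> \<psi>))"

lemma inst_scheme: "inst from_nat (scheme \<phi>) = \<phi>"
  by (induction \<phi>) auto

lemma inst_lsubst: "inst \<sigma> (lsubst \<tau> \<alpha>) = inst (\<lambda>n. inst \<sigma> (\<tau> n)) \<alpha>"
  by (induction \<alpha>) auto

fun Conj :: "'v \<Rightarrow> 'v fm list \<Rightarrow> 'v fm" where
  "Conj p [] = Top p"
| "Conj p (\<phi> # \<phi>s) = And \<phi> (Conj p \<phi>s)"

lemma finite_truth_values: "finite (truth_values m)"
  by (simp add: truth_values_def)

lemma Inf_truth_values:
  assumes "S \<subseteq> truth_values m" "S \<noteq> {}"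
  shows "Inf S \<in> S"
  using assms finite_subset[OF assms(1) finite_truth_values] by (simp add: cInf_eq_Min)

context
  fixes m :: nat
  assumes m: "m \<ge> 2"
begin

lemma one_truth_value: "1 \<in> truth_values m"
  using m tval_in[OF m, of "m - 1"] by (simp add: tval_def)

lemma todot_truth_values:
  assumes "a \<in> truth_values m" "b \<in> truth_values m"
  shows "todot a b \<in> truth_values m"
proof -
  have "todot a b = tneg (timp a (tneg b))" by (auto simp: todot_def tneg_def timp_def)
  then show ?thesis using assms by (simp add: tneg_closed timp_closed m)
qed

lemma hom_truth_value: "h \<in> homs m \<Longrightarrow> h \<phi> \<in> truth_values m"
  by (auto simp: homs_def)

lemma hom_bounds:
  assumes "h \<in> homs m"
  shows "0 \<le> h \<phi>" "h \<phi> \<le> 1"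
  using truth_le_1[OF m] hom_truth_value[OF assms] by auto

lemma hom_simps:
  assumes "h \<in> homs m"
  shows "h (Neg \<phi>) = tneg (h \<phi>)" "h (Imp \<phi> \<psi>) = timp (h \<phi>) (h \<psi>)"
    "h (Or \<phi> \<psi>) = max (h \<phi>) (h \<psi>)" "h (And \<phi> \<psi>) = min (h \<phi>) (h \<psi>)"
    "h (Iff \<phi> \<psi>) = 1 \<longleftrightarrow> h \<phi> = h \<psi>" "h (Top p) = 1"
  using assms hom_bounds[OF assms, of \<phi>] hom_bounds[OF assms, of \<psi>]
  by (auto simp: homs_def Or_def And_def Iff_def Top_def timp_def tneg_def)

lemma hom_inst: "h \<in> homs m \<Longrightarrow> h (inst \<sigma> \<alpha>) = lval (\<lambda>n. h (\<sigma> n)) \<alpha>"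
  by (induction \<alpha>) (auto simp: hom_simps)

lemma lval_scheme_hom:
  assumes "range v \<subseteq> truth_values m"
  shows "(\<lambda>\<phi>. lval v (scheme \<phi>)) \<in> homs m"
proof -
  have "\<forall>n. v n \<in> truth_values m" using assms by auto
  then show ?thesis using lval_closed[OF m] by (auto simp: homs_def)
qed

lemma hom_eq_lval_scheme:
  "h \<in> homs m \<Longrightarrow> h \<phi> = lval (\<lambda>n. h (from_nat n)) (scheme \<phi>)"
  by (metis hom_inst inst_scheme)

text \<open>If no finite \<open>F\<close> worked, the valuations falsifying \<open>\<phi>\<close>
  and those satisfying each \<open>\<sigma>\<close> would form a family with the finite intersection
  property, whose common point contradicts the assumption.\<close>

lemma hom_compactness:
  fixes \<Sigma> :: "'v::countable fm set"
  assumes "\<And>h. h \<in> homs m \<Longrightarrow> (\<forall>\<sigma>\<in>\<Sigma>. h \<sigma> = 1) \<Longrightarrow> h \<phi> = 1"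
  shows "\<exists>F\<subseteq>\<Sigma>. finite F \<and> (\<forall>h\<in>homs m. (\<forall>\<sigma>\<in>F. h \<sigma> = 1) \<longrightarrow> h \<phi> = 1)"
proof (rule ccontr)
  assume neg: "\<not> ?thesis"
  define sat where "sat \<sigma> = {v. lval v (scheme \<sigma>) = 1}" for \<sigma> :: "'v fm"
  define \<P> where "\<P> = insert (- sat \<phi>) (sat ` \<Sigma>)"
  have "\<exists>v. range v \<subseteq> truth_values m \<and> v \<in> \<Inter>\<P>"
  proof (rule finite_valued_compactness[OF finite_truth_values])
    fix P assume "P \<in> \<P>"
    then obtain \<sigma> where \<sigma>: "P = sat \<sigma> \<or> P = - sat \<sigma>" by (auto simp: \<P>_def)
    show "\<exists>N. \<forall>v w. (\<forall>n<N. v n = w n) \<longrightarrow> v \<in> P \<longrightarrow> w \<in> P"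
      using lval_finite_support[of "scheme \<sigma>"] \<sigma> unfolding sat_def
      by (metis (mono_tags, lifting) Compl_iff mem_Collect_eq)
  next
    fix F assume F: "finite F" "F \<subseteq> \<P>"
    then have "finite (F - {- sat \<phi>})" "F - {- sat \<phi>} \<subseteq> sat ` \<Sigma>" by (auto simp: \<P>_def)
    then obtain G where G: "G \<subseteq> \<Sigma>" "finite G" "F - {- sat \<phi>} = sat ` G"
      by (meson finite_subset_image)
    have "\<not> (\<forall>h\<in>homs m. (\<forall>\<sigma>\<in>G. h \<sigma> = 1) \<longrightarrow> h \<phi> = 1)"
      using neg G(1,2) by simp
    then obtain h where h: "h \<in> homs m" "\<forall>\<sigma>\<in>G. h \<sigma> = 1" "h \<phi> \<noteq> 1" by auto
    let ?v = "\<lambda>n. h (from_nat n)"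
    have "?v \<in> sat \<sigma> \<longleftrightarrow> h \<sigma> = 1" for \<sigma>
      using hom_eq_lval_scheme[OF h(1), of \<sigma>] by (simp add: sat_def)
    then have "?v \<in> \<Inter>(insert (- sat \<phi>) (sat ` G))" using h by auto
    moreover have "F \<subseteq> insert (- sat \<phi>) (sat ` G)"
      unfolding G(3)[symmetric] by blast
    ultimately have "?v \<in> \<Inter>F" by blast
    moreover have "range ?v \<subseteq> truth_values m" using hom_truth_value[OF h(1)] by auto
    ultimately show "\<exists>v. range v \<subseteq> truth_values m \<and> v \<in> \<Inter>F" by blast
  qed
  then obtain v where v: "range v \<subseteq> truth_values m" "v \<in> \<Inter>\<P>" by blast
  have "lval v (scheme \<phi>) = 1"
    by (rule assms[OF lval_scheme_hom[OF v(1)]]) (use v(2) in \<open>auto simp: \<P>_def sat_def\<close>)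
  then show False using v(2) by (auto simp: \<P>_def sat_def)
qed

text \<open>The deficits \<open>1 - h \<delta>\<close> accumulate: being nonnegative, they can be
  added before or after truncation at 1.\<close>

lemma hom_foldr_Imp:
  assumes "h \<in> homs m"
  shows "h (foldr Imp \<delta>s \<phi>) = min 1 ((\<Sum>\<delta>\<leftarrow>\<delta>s. 1 - h \<delta>) + h \<phi>)"
proof (induction \<delta>s)
  case Nil
  then show ?case using hom_bounds[OF assms, of \<phi>] by simp
next
  case (Cons \<delta> \<delta>s)
  then show ?case using hom_bounds[OF assms, of \<delta>] by (simp add: hom_simps[OF assms] timp_def)
qed

text \<open>
  A premise with value below 1 has value at most \<open>1 - 1 / (m - 1)\<close>, so that \<open>m - 1\<close> copies of it
  make the iterated implication true; no deduction theorem is needed.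
\<close>

lemma hom_foldr_Imp_replicate:
  assumes h: "h \<in> homs m" and cons: "(\<forall>\<delta>\<in>set \<delta>s. h \<delta> = 1) \<longrightarrow> h \<phi> = 1"
  shows "h (foldr Imp (concat (replicate (m - 1) \<delta>s)) \<phi>) = 1"
proof -
  let ?s = "\<Sum>\<delta>\<leftarrow>\<delta>s. 1 - h \<delta>"
  have sum: "(\<Sum>\<delta>\<leftarrow>concat (replicate k \<delta>s). 1 - h \<delta>) = real k * ?s" for k
    by (induction k) (auto simp: algebra_simps)
  have nonneg: "0 \<le> ?s" using hom_bounds[OF h] by (intro sum_list_nonneg) auto
  have "1 \<le> real (m - 1) * ?s + h \<phi>"
  proof (cases "\<forall>\<delta>\<in>set \<delta>s. h \<delta> = 1")
    case True
    then show ?thesis using cons nonneg by simp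
  next
    case False
    then obtain \<delta> where \<delta>: "\<delta> \<in> set \<delta>s" "h \<delta> \<noteq> 1" by blast
    obtain i where i: "i < m" "h \<delta> = tval m i" using hom_truth_value[OF h] by (rule truth_valuesE)
    with \<delta>(2) m have "i \<noteq> m - 1" by (auto simp: tval_def)
    with i have "real i + 1 \<le> real (m - 1)" by linarith
    then have "1 \<le> real (m - 1) * (1 - h \<delta>)" using m i by (simp add: tval_def field_simps)
    also have "1 - h \<delta> \<le> ?s"
      by (rule member_le_sum_list) (use \<delta> hom_bounds[OF h] in auto)
    then have "real (m - 1) * (1 - h \<delta>) \<le> real (m - 1) * ?s" by (rule mult_left_mono) simp
    finally show ?thesis using hom_bounds(1)[OF h, of \<phi>] by linarith
  qed
  then show ?thesis by (simp add: hom_foldr_Imp[OF h] sum)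
qed

lemma hom_iter_imp:
  assumes "h \<in> homs m" "\<And>i. i \<in> {1..k} \<Longrightarrow> h (\<phi>s i) \<in> {0, 1}"
  shows "h (iter_imp k \<phi>s \<psi>) = (if \<forall>i\<in>{1..k}. h (\<phi>s i) = 1 then h \<psi> else 1)"
  using assms(2)
proof (induction k)
  case (Suc k)
  then have IH: "h (iter_imp k \<phi>s \<psi>) = (if \<forall>i\<in>{1..k}. h (\<phi>s i) = 1 then h \<psi> else 1)" by auto
  have "h (\<phi>s (Suc k)) = 0 \<or> h (\<phi>s (Suc k)) = 1" using Suc.prems[of "Suc k"] by auto
  then show ?case using hom_bounds[OF assms(1), of \<psi>]
    by (auto simp: hom_simps[OF assms(1)] IH timp_def atLeastAtMostSuc_conv)
qed simp

lemma hom_Disj: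
  assumes "h \<in> homs m" "\<phi>s \<noteq> []" "\<And>\<phi>. \<phi> \<in> set \<phi>s \<Longrightarrow> h \<phi> \<in> {0, 1}"
  shows "h (Disj \<phi>s) = (if \<exists>\<phi>\<in>set \<phi>s. h \<phi> = 1 then 1 else 0)"
  using assms(2,3)
proof (induction \<phi>s rule: Disj.induct)
  case (2 \<phi> \<psi> \<phi>s)
  then have IH: "h (Disj (\<psi> # \<phi>s)) = (if \<exists>\<phi>\<in>set (\<psi> # \<phi>s). h \<phi> = 1 then 1 else 0)" by simp
  have "h \<phi> = 0 \<or> h \<phi> = 1" using 2 by simp
  then show ?case by (auto simp: hom_simps[OF assms(1)] IH)
qed auto

lemma hom_Conj:
  assumes "h \<in> homs m" "a \<le> 1"
  shows "a \<le> h (Conj p \<phi>s) \<longleftrightarrow> (\<forall>\<phi>\<in>set \<phi>s. a \<le> h \<phi>)"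
  using assms(2) by (induction \<phi>s) (auto simp: hom_simps[OF assms(1)])

section \<open>The operators J and I under homomorphisms\<close>

context
  fixes J :: "real \<Rightarrow> lfm"
  assumes J: "J_schemes m J"
begin

lemma hom_Jop:
  assumes "h \<in> homs m" "a \<in> truth_values m"
  shows "h (Jop J a \<phi>) = (if h \<phi> = a then 1 else 0)"
  using J hom_truth_value[OF assms(1), of \<phi>] assms
  by (auto simp: Jop_def hom_inst J_schemes_def)

text \<open>The bound \<open>a \<le> 1\<close> puts 1 among the disjuncts, so \<open>Disj\<close>
  never meets the empty list. Inequalities between values can thus be coded as formulae of value
  1.\<close>

lemma hom_Iop:
  assumes h: "h \<in> homs m" and a: "a \<le> 1"
  shows "h (Iop m J a \<phi>) = (if a \<le> h \<phi> then 1 else 0)"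
proof -
  let ?bs = "filter (\<lambda>b. a \<le> b) (truth_list m)"
  have bs: "set ?bs = {b \<in> truth_values m. a \<le> b}" by (auto simp: truth_values_def)
  then have ne: "?bs \<noteq> []" using a one_truth_value
    by (metis (mono_tags, lifting) empty_iff empty_set mem_Collect_eq)
  have "h (Iop m J a \<phi>) = (if \<exists>b\<in>set ?bs. h (Jop J b \<phi>) = 1 then 1 else 0)"
    unfolding Iop_def using ne bs
    by (subst hom_Disj[OF h]) (auto simp: hom_Jop[OF h])
  also have "(\<exists>b\<in>set ?bs. h (Jop J b \<phi>) = 1) \<longleftrightarrow> a \<le> h \<phi>"
    using hom_truth_value[OF h, of \<phi>] unfolding bs by (auto simp: hom_Jop[OF h])
  finally show ?thesis .
qed

text \<open>Truth of \<open>Jop J (h \<phi>) \<phi>\<close> pins down the value of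
  \<open>\<phi>\<close>, so the true formulae determine a homomorphism and can serve as its
  code.\<close>

lemma hom_eqI:
  assumes "h \<in> homs m" "g \<in> homs m" "{\<theta>. h \<theta> = 1} = {\<theta>. g \<theta> = 1}"
  shows "h = g"
proof
  fix \<phi>
  have "h (Jop J (h \<phi>) \<phi>) = 1" using hom_Jop assms(1) hom_truth_value by metis
  then have "g (Jop J (h \<phi>) \<phi>) = 1" using assms(3) by blast
  then show "h \<phi> = g \<phi>" using hom_Jop assms hom_truth_value by (metis zero_neq_one)
qed

end

end


section \<open>Derivability\<close>

lemma LCR_derives_thm: "LCR_thm m Ax J p \<phi> \<Longrightarrow> LCR_derives m Ax J p \<Gamma> \<phi>"
  unfolding LCR_derives_def by (rule exI[of _ "[\<phi>]"]) simp

lemma LCR_derives_assumption: "\<phi> \<in> \<Gamma> \<Longrightarrow> LCR_derives m Ax J p \<Gamma> \<phi>"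
  unfolding LCR_derives_def by (rule exI[of _ "[\<phi>]"]) simp

text \<open>Concatenate the two derivations and append \<open>\<psi>\<close>; references inside the
  second are shifted by \<open>length as\<close>.\<close>

lemma LCR_derives_MP:
  assumes "LCR_derives m Ax J p \<Gamma> \<phi>" "LCR_derives m Ax J p \<Gamma> (Imp \<phi> \<psi>)"
  shows "LCR_derives m Ax J p \<Gamma> \<psi>"
proof -
  define ok where "ok ds i \<longleftrightarrow> LCR_thm m Ax J p (ds ! i) \<or> ds ! i \<in> \<Gamma> \<or>
    (\<exists>j<i. \<exists>k<i. ds ! k = Imp (ds ! j) (ds ! i))" for ds and i :: nat
  obtain as where as: "as \<noteq> []" "last as = \<phi>" "\<forall>i<length as. ok as i"
    using assms(1) unfolding LCR_derives_def ok_def by blast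
  obtain bs where bs: "bs \<noteq> []" "last bs = Imp \<phi> \<psi>" "\<forall>i<length bs. ok bs i"
    using assms(2) unfolding LCR_derives_def ok_def by blast
  let ?ds = "as @ bs @ [\<psi>]" and ?a = "length as" and ?b = "length bs"
  have nth_bs: "?ds ! (?a + i) = bs ! i" if "i < ?b" for i
    using that by (simp add: nth_append)
  have "ok ?ds i" if i: "i < length ?ds" for i
  proof -
    consider "i < ?a" | j where "i = ?a + j" "j < ?b" | "i = ?a + ?b"
      using i that(2)[of "i - ?a"] by (cases "i < ?a"; cases "i < ?a + ?b") auto
    then show ?thesis
    proof cases
      case 1
      then have "ok as i" using as(3) by blast
      moreover have "?ds ! j = as ! j" if "j \<le> i" for j using that 1 by (simp add: nth_append)
      ultimately show ?thesis unfolding ok_def by (metis less_imp_le order_refl)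
    next
      case (2 j)
      then have "ok bs j" using bs(3) by blast
      then show ?thesis unfolding ok_def
      proof (elim disjE exE conjE)
        fix k l assume "k < j" "l < j" "bs ! l = Imp (bs ! k) (bs ! j)"
        then have "?ds ! (?a + l) = Imp (?ds ! (?a + k)) (?ds ! i)" "?a + k < i" "?a + l < i"
          using 2 by (simp_all add: nth_append)
        then show "LCR_thm m Ax J p (?ds ! i) \<or> ?ds ! i \<in> \<Gamma> \<or>
          (\<exists>j<i. \<exists>k<i. ?ds ! k = Imp (?ds ! j) (?ds ! i))" by blast
      qed (use 2 nth_bs in auto)
    next
      case 3
      have "?ds ! (?a - 1) = \<phi>" using as(1,2) by (simp add: nth_append last_conv_nth)
      moreover have "?ds ! (?a + (?b - 1)) = Imp \<phi> \<psi>"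
        using bs(1,2) by (subst nth_bs) (simp_all add: last_conv_nth)
      moreover have "?ds ! i = \<psi>" using 3 by (simp add: nth_append)
      moreover have "?a - 1 < i" "?a + (?b - 1) < i" using as(1) bs(1) 3
        by (simp_all add: add.commute less_imp_diff_less)
      ultimately show ?thesis unfolding ok_def by metis
    qed
  qed
  moreover have "last ?ds = \<psi>" "?ds \<noteq> []" by auto
  ultimately show ?thesis unfolding LCR_derives_def ok_def by blast
qed

lemma foldr_Imp_MP:
  assumes "\<And>\<phi> \<psi>. D \<phi> \<Longrightarrow> D (Imp \<phi> \<psi>) \<Longrightarrow> D \<psi>" "D (foldr Imp \<delta>s \<phi>)" "\<forall>\<delta>\<in>set \<delta>s. D \<delta>"
  shows "D \<phi>"
  using assms(2,3)
proof (induction \<delta>s)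
  case (Cons \<delta> \<delta>s)
  have "D (foldr Imp \<delta>s \<phi>)" by (rule assms(1)[of \<delta>]) (use Cons.prems in simp_all)
  with Cons show ?case by simp
qed simp


section \<open>The canonical model\<close>

locale LCR_system =
  fixes m :: nat and Ax :: "lfm set" and J :: "real \<Rightarrow> lfm" and p :: "'v::countable"
  assumes m: "m \<ge> 2"
    and Ax: "L_axiomatization m Ax"
    and J: "J_schemes m J"
begin

abbreviation thm_LCR :: "'v fm \<Rightarrow> bool" where
  "thm_LCR \<equiv> LCR_thm m Ax J p"

definition W :: "('v fm \<Rightarrow> real) set" where
  "W = {h \<in> homs m. \<forall>\<theta>. thm_LCR \<theta> \<longrightarrow> h \<theta> = 1}"

lemma W_homs: "h \<in> W \<Longrightarrow> h \<in> homs m"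
  by (simp add: W_def)

lemma W_thm: "h \<in> W \<Longrightarrow> thm_LCR \<theta> \<Longrightarrow> h \<theta> = 1"
  by (simp add: W_def)

lemma thm_inst: "L_thm Ax \<alpha> \<Longrightarrow> thm_LCR (inst \<sigma> \<alpha>)"
proof (induction rule: L_thm.induct)
  case (L_Ax \<alpha> \<tau>)
  then show ?case unfolding inst_lsubst by (rule LCR_thm.Ax)
next
  case (L_MP \<alpha> \<beta>)
  show ?case by (rule LCR_thm.MP[OF L_MP.IH(1) L_MP.IH(2)[unfolded inst.simps]])
qed

text \<open>Completeness of the propositional base enters here: \<open>scheme \<phi>\<close> is a
  tautology, hence derivable, and instantiating its atoms back gives \<open>\<phi>\<close>.\<close>

lemma thm_taut:
  assumes "\<And>h. h \<in> homs m \<Longrightarrow> h \<phi> = 1"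
  shows "thm_LCR \<phi>"
proof -
  have "ltaut m (scheme \<phi>)" unfolding ltaut_def
    using assms[OF lval_scheme_hom[OF m]] by (simp add: image_subset_iff)
  then have "thm_LCR (inst from_nat (scheme \<phi>))"
    using Ax thm_inst by (auto simp: L_axiomatization_def)
  then show ?thesis by (simp add: inst_scheme)
qed

text \<open>An arbitrary \<open>D\<close> covers both theoremhood and derivability from
  \<open>\<Gamma>\<close>. Since \<open>D\<close> contains the theorems, homomorphisms true on
  \<open>D\<close> lie in \<open>W\<close>; compactness leaves finitely many members of
  \<open>D\<close>, which become the premises of one theorem.\<close>

lemma W_consequence_closed:
  fixes D :: "'v fm \<Rightarrow> bool"
  assumes MP: "\<And>\<phi> \<psi>. D \<phi> \<Longrightarrow> D (Imp \<phi> \<psi>) \<Longrightarrow> D \<psi>"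
    and theorems: "\<And>\<theta>. thm_LCR \<theta> \<Longrightarrow> D \<theta>"
    and W: "\<And>h. h \<in> W \<Longrightarrow> (\<forall>\<psi>. D \<psi> \<longrightarrow> h \<psi> = 1) \<Longrightarrow> h \<phi> = 1"
  shows "D \<phi>"
proof -
  have "h \<phi> = 1" if "h \<in> homs m" "\<forall>\<sigma>\<in>Collect D. h \<sigma> = 1" for h
    by (rule W) (use that theorems in \<open>auto simp: W_def\<close>)
  then obtain F where F: "F \<subseteq> Collect D" "finite F"
    "\<forall>h\<in>homs m. (\<forall>\<sigma>\<in>F. h \<sigma> = 1) \<longrightarrow> h \<phi> = 1"
    using hom_compactness[OF m, of "Collect D" \<phi>] by blast
  obtain \<delta>s where \<delta>s: "set \<delta>s = F" using F(2) finite_list by blast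
  have "thm_LCR (foldr Imp (concat (replicate (m - 1) \<delta>s)) \<phi>)"
    using F(3) \<delta>s by (intro thm_taut hom_foldr_Imp_replicate[OF m]) auto
  then have imp: "D (foldr Imp (concat (replicate (m - 1) \<delta>s)) \<phi>)" by (rule theorems)
  have prems: "\<forall>\<delta>\<in>set (concat (replicate (m - 1) \<delta>s)). D \<delta>" using F(1) \<delta>s by auto
  show ?thesis by (rule foldr_Imp_MP[of D]) (fact MP imp prems)+
qed

lemma thm_if_W: "(\<And>h. h \<in> W \<Longrightarrow> h \<phi> = 1) \<Longrightarrow> thm_LCR \<phi>"
  by (rule W_consequence_closed[where D = thm_LCR]) (erule (1) LCR_thm.MP, assumption, blast)

lemma W_compactness:
  assumes "\<And>h. h \<in> W \<Longrightarrow> (\<forall>\<sigma>\<in>\<Sigma>. h \<sigma> = 1) \<Longrightarrow> h \<phi> = 1"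
  shows "\<exists>F\<subseteq>\<Sigma>. finite F \<and> (\<forall>h\<in>W. (\<forall>\<sigma>\<in>F. h \<sigma> = 1) \<longrightarrow> h \<phi> = 1)"
proof -
  have "h \<phi> = 1" if "h \<in> homs m" "\<forall>\<sigma>\<in>\<Sigma> \<union> Collect thm_LCR. h \<sigma> = 1" for h
    using that assms[of h] by (auto simp: W_def)
  then obtain F where "F \<subseteq> \<Sigma> \<union> Collect thm_LCR" "finite F"
    "\<forall>h\<in>homs m. (\<forall>\<sigma>\<in>F. h \<sigma> = 1) \<longrightarrow> h \<phi> = 1"
    using hom_compactness[OF m, of "\<Sigma> \<union> Collect thm_LCR" \<phi>] by blast
  then show ?thesis by (intro exI[of _ "F \<inter> \<Sigma>"]) (unfold W_def, blast)
qed

section \<open>The canonical relation\<close>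

lemma W_timp_truth_value:
  assumes "h \<in> W" "g \<in> W"
  shows "timp (h \<phi>) (g \<psi>) \<in> truth_values m"
  using assms by (intro timp_closed[OF m] hom_truth_value[OF m] W_homs)

text \<open>Between worlds this is, by residuation, the greatest \<open>c \<le> 1\<close> with
  \<open>h (Cond \<phi> \<chi>) \<le> timp c (g \<chi>)\<close> for every
  \<open>\<chi>\<close>.\<close>

definition R :: "'v fm \<Rightarrow> ('v fm \<Rightarrow> real) \<Rightarrow> ('v fm \<Rightarrow> real) \<Rightarrow> real" where
  "R \<phi> h g = (INF \<chi>. timp (h (Cond \<phi> \<chi>)) (g \<chi>))"

lemma R_attained:
  assumes "h \<in> W" "g \<in> W"
  shows "R \<phi> h g \<in> range (\<lambda>\<chi>. timp (h (Cond \<phi> \<chi>)) (g \<chi>))"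
  unfolding R_def
  using W_timp_truth_value[OF assms] by (intro Inf_truth_values) auto

lemma R_truth_value:
  assumes "h \<in> W" "g \<in> W"
  shows "R \<phi> h g \<in> truth_values m"
  using R_attained[OF assms, of \<phi>] W_timp_truth_value[OF assms] by auto

lemma R_le:
  assumes "h \<in> W" "g \<in> W"
  shows "R \<phi> h g \<le> timp (h (Cond \<phi> \<chi>)) (g \<chi>)"
  unfolding R_def
proof (rule cINF_lower)
  have "range (\<lambda>\<chi>. timp (h (Cond \<phi> \<chi>)) (g \<chi>)) \<subseteq> truth_values m"
    using W_timp_truth_value[OF assms] by blast
  then show "bdd_below (range (\<lambda>\<chi>. timp (h (Cond \<phi> \<chi>)) (g \<chi>)))"
    using finite_truth_values finite_subset by (metis bdd_below_finite)
qed simp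

text \<open>Agreement throughout \<open>W\<close> makes \<open>Iff \<phi> \<psi>\<close> a theorem,
  to which RCEA applies. This makes a relation indexed by extensions well defined.\<close>

lemma R_cong:
  assumes "h \<in> W" "\<And>k. k \<in> W \<Longrightarrow> k \<phi> = k \<psi>"
  shows "R \<phi> h g = R \<psi> h g"
proof -
  have "thm_LCR (Iff \<phi> \<psi>)"
    by (rule thm_if_W) (simp add: hom_simps[OF m W_homs] assms(2))
  then have "h (Iff (Cond \<phi> \<chi>) (Cond \<psi> \<chi>)) = 1" for \<chi>
    by (intro W_thm[OF assms(1)] LCR_thm.RCEA)
  then show ?thesis by (simp add: R_def hom_simps[OF m W_homs[OF assms(1)]])
qed

text \<open>Axiom A3 handles the empty list, A2 each further conjunct.\<close>

lemma Cond_Conj: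
  assumes h: "h \<in> W" and le: "a \<le> 1" "\<forall>\<chi>\<in>set \<chi>s. a \<le> h (Cond \<phi> \<chi>)"
  shows "a \<le> h (Cond \<phi> (Conj p \<chi>s))"
  using le(2)
proof (induction \<chi>s)
  case Nil
  have "h (Cond \<phi> (Top p)) = 1" by (rule W_thm[OF h LCR_thm.A3])
  then show ?case using le(1) by simp
next
  case (Cons \<chi> \<chi>s)
  have "h (Imp (And (Cond \<phi> \<chi>) (Cond \<phi> (Conj p \<chi>s))) (Cond \<phi> (And \<chi> (Conj p \<chi>s)))) = 1"
    by (rule W_thm[OF h LCR_thm.A2])
  then have "min (h (Cond \<phi> \<chi>)) (h (Cond \<phi> (Conj p \<chi>s))) \<le> h (Cond \<phi> (And \<chi> (Conj p \<chi>s)))"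
    by (simp add: hom_simps[OF m W_homs[OF h]] timp_def)
  then show ?case using Cons by auto
qed

text \<open>
  The hypothesis says that \<open>b \<le> h R\<^sub>\<phi> g\<close> implies \<open>a \<odot> b \<le> g \<psi>\<close>, by residuation.
\<close>

lemma Cond_ge:
  assumes h: "h \<in> W" and a: "a \<in> truth_values m"
    and ent: "\<And>b g. b \<in> truth_values m \<Longrightarrow> g \<in> W \<Longrightarrow>
      (\<forall>\<chi>. todot (h (Cond \<phi> \<chi>)) b \<le> g \<chi>) \<Longrightarrow> todot a b \<le> g \<psi>"
  shows "a \<le> h (Cond \<phi> \<psi>)"
proof -
  note homs = W_homs and tv = hom_truth_value[OF m W_homs]
  have todot_le: "todot c b \<le> 1" if "c \<in> truth_values m" "b \<in> truth_values m" for b c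
    using truth_le_1[OF m todot_truth_values[OF m that]] by simp
  have Iop: "g (Iop m J c \<chi>) = (if c \<le> g \<chi> then 1 else 0)" if "g \<in> W" "c \<le> 1" for g c \<chi>
    using hom_Iop[OF m J homs] that by blast
  have "\<exists>X. finite X \<and> (\<forall>g\<in>W. (\<forall>\<chi>\<in>X. todot (h (Cond \<phi> \<chi>)) b \<le> g \<chi>) \<longrightarrow> todot a b \<le> g \<psi>)"
    if b: "b \<in> truth_values m" for b
  proof -
    let ?\<Sigma> = "range (\<lambda>\<chi>. Iop m J (todot (h (Cond \<phi> \<chi>)) b) \<chi>)"
    note le = todot_le[OF tv[OF h] b] todot_le[OF a b]
    have "\<exists>F\<subseteq>?\<Sigma>. finite F \<and>
      (\<forall>g\<in>W. (\<forall>\<sigma>\<in>F. g \<sigma> = 1) \<longrightarrow> g (Iop m J (todot a b) \<psi>) = 1)"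
      by (rule W_compactness) (use ent[OF b] le in \<open>auto simp: Iop split: if_splits\<close>)
    then obtain F where F: "F \<subseteq> ?\<Sigma>" "finite F"
      "\<forall>g\<in>W. (\<forall>\<sigma>\<in>F. g \<sigma> = 1) \<longrightarrow> g (Iop m J (todot a b) \<psi>) = 1" by blast
    from F(1,2) obtain X where
      X: "finite X" "F = (\<lambda>\<chi>. Iop m J (todot (h (Cond \<phi> \<chi>)) b) \<chi>) ` X"
      by (meson finite_subset_image)
    show ?thesis by (intro exI[of _ X]) (use X F(3) le in \<open>auto simp: Iop split: if_splits\<close>)
  qed
  then obtain X where X: "\<And>b. b \<in> truth_values m \<Longrightarrow> finite (X b)"
    "\<And>b g. b \<in> truth_values m \<Longrightarrow> g \<in> W \<Longrightarrow>
      (\<forall>\<chi>\<in>X b. todot (h (Cond \<phi> \<chi>)) b \<le> g \<chi>) \<Longrightarrow> todot a b \<le> g \<psi>"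
    by metis
  \<comment> \<open>There are finitely many \<open>b\<close>, so one list serves all premises of
    rule \<open>R\<close>.\<close>
  have "finite (\<Union>b\<in>truth_values m. X b)" using X(1) finite_truth_values by blast
  from finite_list[OF this] obtain \<chi>s where \<chi>s: "set \<chi>s = (\<Union>b\<in>truth_values m. X b)" ..
  \<comment> \<open>These are the \<open>a_i\<close> of the rule, falling from 1 at
    \<open>i = 1\<close> to 0 at \<open>i = m\<close>; value \<open>tval m j\<close> belongs to
    index \<open>m - j\<close>.\<close>
  define c where "c i = tval m (m - i)" for i
  \<comment> \<open>Sorting by exact value gives one conjunction for each index of the rule; an
    empty class yields \<open>Top p\<close>.\<close>
  define \<gamma>s where "\<gamma>s i = Conj p (filter (\<lambda>\<chi>. h (Cond \<phi> \<chi>) = c i) \<chi>s)" for i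
  have c: "c i \<in> truth_values m" if "i \<in> {1..m}" for i
    using that m by (auto simp: c_def intro: tval_in)
  have c1: "c i \<le> 1" if "i \<in> {1..m}" for i using truth_le_1[OF m c[OF that]] by simp
  have a1: "a \<le> 1" using truth_le_1[OF m a] by simp
  have "thm_LCR (iter_imp m (\<lambda>i. Iop m J (todot (c i) b) (\<gamma>s i)) (Iop m J (todot a b) \<psi>))"
    if b: "b \<in> truth_values m" for b
  proof (rule thm_if_W)
    fix g assume g: "g \<in> W"
    have "todot a b \<le> g \<psi>" if all: "\<forall>i\<in>{1..m}. todot (c i) b \<le> g (\<gamma>s i)"
    proof (rule X(2)[OF b g], rule ballI)
      fix \<chi> assume "\<chi> \<in> X b"
      then have \<chi>: "\<chi> \<in> set \<chi>s" using \<chi>s b by auto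
      obtain j where j: "j < m" "h (Cond \<phi> \<chi>) = tval m j" using tv[OF h] by (rule truth_valuesE)
      then have i: "m - j \<in> {1..m}" "h (Cond \<phi> \<chi>) = c (m - j)" by (auto simp: c_def)
      have "todot (c (m - j)) b \<le> g (\<gamma>s (m - j))" using all i(1) by blast
      then show "todot (h (Cond \<phi> \<chi>)) b \<le> g \<chi>"
        unfolding \<gamma>s_def hom_Conj[OF m homs[OF g] todot_le[OF c[OF i(1)] b]]
        using \<chi> i(2) by simp
    qed
    then show "g (iter_imp m (\<lambda>i. Iop m J (todot (c i) b) (\<gamma>s i)) (Iop m J (todot a b) \<psi>)) = 1"
      using todot_le[OF c b] todot_le[OF a b]
      by (subst hom_iter_imp[OF m homs[OF g]]) (auto simp: Iop[OF g] split: if_splits)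
  qed
  then have "thm_LCR (iter_imp m (\<lambda>i. Iop m J (c i) (Cond \<phi> (\<gamma>s i))) (Iop m J a (Cond \<phi> \<psi>)))"
    unfolding c_def by (rule LCR_thm.R[OF a])
  then have "h (iter_imp m (\<lambda>i. Iop m J (c i) (Cond \<phi> (\<gamma>s i))) (Iop m J a (Cond \<phi> \<psi>))) = 1"
    by (rule W_thm[OF h])
  \<comment> \<open>All premises of the implication hold at \<open>h\<close>, since each conjunct of
    \<open>\<gamma>s i\<close> has a conditional of value exactly \<open>c i\<close>.\<close>
  moreover have "c i \<le> h (Cond \<phi> (\<gamma>s i))" if "i \<in> {1..m}" for i
    unfolding \<gamma>s_def by (rule Cond_Conj[OF h c1[OF that]]) simp
  ultimately have "h (Iop m J a (Cond \<phi> \<psi>)) = 1"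
    using c1 by (subst (asm) hom_iter_imp[OF m homs[OF h]]) (auto simp: Iop[OF h])
  then show ?thesis using Iop[OF h a1] by (simp split: if_splits)
qed

text \<open>One inequality is residuation applied to \<open>R_le\<close>. The other is
  \<open>Cond_ge\<close> with the infimum itself as \<open>a\<close>, which is a truth value because
  there are only finitely many.\<close>

lemma Cond_eq_INF:
  assumes h: "h \<in> W"
  shows "h (Cond \<phi> \<psi>) = (INF g\<in>W. timp (R \<phi> h g) (g \<psi>))"
proof (rule antisym)
  note tv = hom_truth_value[OF m W_homs]
  let ?S = "(\<lambda>g. timp (R \<phi> h g) (g \<psi>)) ` W"
  have S: "?S \<subseteq> truth_values m"
    using timp_closed[OF m R_truth_value[OF h] tv] by auto
  show "h (Cond \<phi> \<psi>) \<le> Inf ?S"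
  proof (rule cINF_greatest)
    fix g assume g: "g \<in> W"
    have "R \<phi> h g \<le> timp (h (Cond \<phi> \<psi>)) (g \<psi>)" by (rule R_le[OF h g])
    then show "h (Cond \<phi> \<psi>) \<le> timp (R \<phi> h g) (g \<psi>)"
      using truth_le_1[OF m tv[OF h]] by (auto simp: timp_def)
  qed (use h in blast)
  have Inf: "Inf ?S \<in> truth_values m" using Inf_truth_values[OF S] S h by blast
  show "Inf ?S \<le> h (Cond \<phi> \<psi>)"
  proof (rule Cond_ge[OF h Inf])
    fix b g assume b: "b \<in> truth_values m" and g: "g \<in> W"
      and le: "\<forall>\<chi>. todot (h (Cond \<phi> \<chi>)) b \<le> g \<chi>"
    \<comment> \<open>A formula attaining the infimum in \<open>R\<close> turns the inequalities
      into \<open>b \<le> R \<phi> h g\<close>.\<close>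
    obtain \<chi> where "R \<phi> h g = timp (h (Cond \<phi> \<chi>)) (g \<chi>)" using R_attained[OF h g, of \<phi>] by blast
    then have "b \<le> R \<phi> h g"
      using le[rule_format, of \<chi>] truth_le_1[OF m b] by (auto simp: timp_def todot_def)
    moreover have "Inf ?S \<le> timp (R \<phi> h g) (g \<psi>)"
      using S g finite_subset[OF S finite_truth_values] by (intro cINF_lower bdd_below_finite) auto
    ultimately show "todot (Inf ?S) b \<le> g \<psi>"
      using truth_le_1[OF m tv[OF g, of \<psi>]] by (auto simp: timp_def todot_def)
  qed
qed

section \<open>The canonical model over the given type of worlds\<close>

context
  fixes e :: "'v fm set \<Rightarrow> 'w"
  assumes e: "inj e"
begin

text \<open>The injection \<open>e\<close> takes sets of formulae, so a world is coded by its true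
  formulae; \<open>hom_eqI\<close> ensures that distinct worlds get distinct codes.\<close>

definition world :: "('v fm \<Rightarrow> real) \<Rightarrow> 'w" where
  "world h = e {\<theta>. h \<theta> = 1}"

definition hom_of :: "'w \<Rightarrow> 'v fm \<Rightarrow> real" where
  "hom_of = inv_into W world"

text \<open>This is what \<open>ext\<close> turns out to be in the canonical model, written without
  \<open>eval\<close> so that the relation can be defined before the truth lemma.\<close>

definition canonical_ext :: "'v fm \<Rightarrow> 'w set list" where
  "canonical_ext \<phi> = map (\<lambda>i. world ` {h \<in> W. h \<phi> = tval m (i - 1)}) [1..<Suc m]"

text \<open>All tuples of the right shape are admissible. For one that is no extension,
  \<open>SOME\<close> returns an arbitrary formula, and \<open>R\<close> still takes truth values
  between worlds.\<close>

definition canonical :: "('w, 'v) kripke" where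
  "canonical = \<lparr>worlds = world ` W,
     adm = {X. length X = m \<and> set X \<subseteq> Pow (world ` W)},
     rel = (\<lambda>X x y. R (SOME \<phi>. canonical_ext \<phi> = X) (hom_of x) (hom_of y)),
     val = (\<lambda>q x. hom_of x (Var q))\<rparr>"

lemma inj_on_world: "inj_on world W"
proof (rule inj_onI)
  fix h g assume h: "h \<in> W" and g: "g \<in> W" and eq: "world h = world g"
  have "{\<theta>. h \<theta> = 1} = {\<theta>. g \<theta> = 1}" by (rule injD[OF e]) (use eq in \<open>simp add: world_def\<close>)
  then show "h = g" by (rule hom_eqI[OF m J W_homs[OF h] W_homs[OF g]])
qed

lemma hom_of_world: "h \<in> W \<Longrightarrow> hom_of (world h) = h"
  by (simp add: hom_of_def inj_on_world)

text \<open>A world lies in the coordinate recording its value, and \<open>world\<close> is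
  injective on \<open>W\<close>, so the tuple determines the value at every world.\<close>

lemma canonical_ext_eqD:
  assumes eq: "canonical_ext \<phi> = canonical_ext \<psi>" and h: "h \<in> W"
  shows "h \<phi> = h \<psi>"
proof -
  obtain j where j: "j < m" "h \<phi> = tval m j"
    using hom_truth_value[OF m W_homs[OF h]] by (rule truth_valuesE)
  have "Suc j \<in> set [1..<Suc m]" using j(1) by auto
  then have "world ` {h \<in> W. h \<phi> = tval m j} = world ` {h \<in> W. h \<psi> = tval m j}"
    using eq unfolding canonical_ext_def map_eq_conv by fastforce
  then have "{h \<in> W. h \<phi> = tval m j} = {h \<in> W. h \<psi> = tval m j}"
    by (subst (asm) inj_on_image_eq_iff[OF inj_on_world]) auto
  moreover have "h \<in> {h \<in> W. h \<phi> = tval m j}" using h j(2) by simp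
  ultimately have "h \<in> {h \<in> W. h \<psi> = tval m j}" by simp
  then show ?thesis using j(2) by simp
qed

text \<open>The formula chosen by \<open>SOME\<close> may differ from \<open>\<phi>\<close> but has
  the same extension, so \<open>R_cong\<close> applies.\<close>

lemma rel_canonical:
  assumes "h \<in> W" "g \<in> W"
  shows "rel canonical (canonical_ext \<phi>) (world h) (world g) = R \<phi> h g"
proof -
  have "canonical_ext (SOME \<psi>. canonical_ext \<psi> = canonical_ext \<phi>) = canonical_ext \<phi>"
    by (rule someI) simp
  then show ?thesis using assms
    by (auto simp: canonical_def hom_of_world intro!: R_cong dest: canonical_ext_eqD)
qed

text \<open>For \<open>Cond\<close>, the induction hypothesis on the antecedent at all worlds
  identifies \<open>ext\<close> with \<open>canonical_ext\<close>; \<open>rel_canonical\<close> and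
  \<open>Cond_eq_INF\<close> do the rest.\<close>

lemma truth_lemma: "h \<in> W \<Longrightarrow> eval m canonical \<phi> (world h) = h \<phi>"
proof (induction \<phi> arbitrary: h)
  case (Var q)
  then show ?case by (simp add: canonical_def hom_of_world)
next
  case (Cond \<phi> \<psi>)
  have "ext m canonical \<phi> = canonical_ext \<phi>"
    unfolding ext_def canonical_ext_def using Cond.IH(1) by (auto simp: canonical_def)
  moreover have "worlds canonical = world ` W" by (simp add: canonical_def)
  ultimately have "eval m canonical (Cond \<phi> \<psi>) (world h) = (INF g\<in>W. timp (R \<phi> h g) (g \<psi>))"
    by (simp only: eval_Cond image_image)
      (rule INF_cong, simp_all add: rel_canonical Cond)
  then show ?case by (simp add: Cond_eq_INF[OF Cond.prems])
next
  case (Neg \<phi>)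
  then show ?case by (simp add: hom_simps(1)[OF m W_homs[OF Neg.prems]])
next
  case (Imp \<phi> \<psi>)
  then show ?case by (simp add: hom_simps(2)[OF m W_homs[OF Imp.prems]])
qed

lemma LCR_model_canonical:
  assumes "W \<noteq> {}"
  shows "LCR_model m canonical"
proof -
  have hom_of: "hom_of x \<in> W" if "x \<in> world ` W" for x
    using inv_into_into[OF that] by (simp add: hom_of_def)
  have "rel canonical X x y \<in> truth_values m"
    if "x \<in> world ` W" "y \<in> world ` W" for X x y
    using R_truth_value[OF hom_of[OF that(1)] hom_of[OF that(2)]] by (simp add: canonical_def)
  moreover have "val canonical q x \<in> truth_values m" if "x \<in> world ` W" for q x
    using hom_truth_value[OF m W_homs[OF hom_of[OF that]]] by (simp add: canonical_def)
  moreover have "ext m canonical \<phi> \<in> adm canonical" for \<phi>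
    by (auto simp: canonical_def ext_def)
  moreover have "worlds canonical = world ` W"
    "adm canonical = {X. length X = m \<and> set X \<subseteq> Pow (world ` W)}"
    by (simp_all add: canonical_def)
  ultimately show ?thesis using assms by (simp add: LCR_model_def)
qed

end

end

theorem theorem2p18:
  fixes m :: nat and Ax :: "lfm set" and J :: "real \<Rightarrow> lfm"
    and p :: "'v::countable" and \<Gamma> :: "'v fm set" and \<phi> :: "'v fm"
  assumes "m \<ge> 2"
    and "L_axiomatization m Ax"
    and "J_schemes m J"
    and large: "\<exists>e :: 'v fm set \<Rightarrow> 'w. inj e"
    and "entails m (LCR_models m :: ('w, 'v) kripke set) \<Gamma> \<phi>"
  shows "LCR_derives m Ax J p \<Gamma> \<phi>"
proof -
  interpret LCR_system m Ax J p using assms(1-3) by unfold_locales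
  obtain e :: "'v fm set \<Rightarrow> 'w" where e: "inj e" using large by blast
  show ?thesis
  \<comment> \<open>It suffices to treat worlds at which everything derivable from
    \<open>\<Gamma>\<close> is true; such an \<open>h\<close> makes \<open>W\<close> nonempty and
    satisfies \<open>\<Gamma>\<close> in the canonical model.\<close>
  proof (rule W_consequence_closed[where D = "LCR_derives m Ax J p \<Gamma>"])
    fix h assume h: "h \<in> W" and D: "\<forall>\<psi>. LCR_derives m Ax J p \<Gamma> \<psi> \<longrightarrow> h \<psi> = 1"
    have "canonical e \<in> LCR_models m"
      using LCR_model_canonical[OF e] h by (auto simp: LCR_models_def)
    moreover have "world e h \<in> worlds (canonical e)" using h by (simp add: canonical_def[OF e])
    moreover have "\<forall>\<psi>\<in>\<Gamma>. eval m (canonical e) \<psi> (world e h) = 1"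
      unfolding truth_lemma[OF e h] using D LCR_derives_assumption[where \<Gamma> = \<Gamma>] by metis
    ultimately have "eval m (canonical e) \<phi> (world e h) = 1"
      using assms(5) unfolding entails_def by metis
    then show "h \<phi> = 1" by (simp add: truth_lemma[OF e h])
  qed (erule (1) LCR_derives_MP, erule LCR_derives_thm)
qed

end
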